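(* There exist a low computably enumerable set $A \subseteq \omega$ and a total binary function $h:\omega\times\omega\to\omega$ with $h \leq_T A$ such that for every total computable function $f:\omega\to\omega$ there exists $n\in\omega$ with $$W_{f(n)} \neq W_{h(n,f(n))}.$$
   Context: Let $\varphi_e$ denote the $e$-th partial computable function in a standard acceptable enumeration, and $W_e$ its domain. A set $A$ is low if its Turing jump satisfies $A' \equiv_T \emptyset'$, where $\emptyset'$ is the halting set. $h\leq_T A$ means $h$ is computable with oracle $A$. *)

theory Defs
  imports Main "HOL-Library.Nat_Bijection"
begin

text \<open>
  Oracle computability is defined by Kleene's schemes for functions that are partial recursive
  in a set. All functions are unary; several arguments are packed into one number with the Cantor
  pairing function \<^const>\<open>prod_encode\<close>, which \<open>Lft\<close>, \<open>Rgt\<close> and \<open>Fork\<close> make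
  available to programs. The identity is \<open>Fork Lft Rgt\<close>.
\<close>

datatype prog =
    Zero
  | Succ
  | Lft
  | Rgt
  | Query
  | Fork prog prog
  | Comp prog prog
  | PrimRec prog prog
  | Mu prog

abbreviation npair :: "nat \<Rightarrow> nat \<Rightarrow> nat" where
  "npair a b \<equiv> prod_encode (a, b)"

primrec eval :: "nat set \<Rightarrow> prog \<Rightarrow> nat \<Rightarrow> nat option" where
  "eval A Zero x = Some 0"
| "eval A Succ x = Some (Suc x)"
| "eval A Lft x = Some (fst (prod_decode x))"
| "eval A Rgt x = Some (snd (prod_decode x))"
| "eval A Query x = Some (if x \<in> A then 1 else 0)"
| "eval A (Fork p q) x =
    Option.bind (eval A p x) (\<lambda>a. Option.bind (eval A q x) (\<lambda>b. Some (npair a b)))"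
| "eval A (Comp p q) x = Option.bind (eval A q x) (eval A p)"
| "eval A (PrimRec p q) x =
    (let (a, n) = prod_decode x
     in rec_nat (eval A p a)
          (\<lambda>m r. Option.bind r (\<lambda>v. eval A q (npair a (npair m v)))) n)"
| "eval A (Mu p) x =
    (if \<exists>n. eval A p (npair x n) = Some 0 \<and> (\<forall>m<n. eval A p (npair x m) \<noteq> None)
     then Some (LEAST n. eval A p (npair x n) = Some 0)
     else None)"

primrec encode :: "prog \<Rightarrow> nat" where
  "encode Zero = 0"
| "encode Succ = 1"
| "encode Lft = 2"
| "encode Rgt = 3"
| "encode Query = 4"
| "encode (Fork p q) = 5 + 4 * npair (encode p) (encode q)"
| "encode (Comp p q) = 6 + 4 * npair (encode p) (encode q)"
| "encode (PrimRec p q) = 7 + 4 * npair (encode p) (encode q)"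
| "encode (Mu p) = 8 + 4 * encode p"

lemma inj_encode: "inj encode"
proof (rule injI)
  show "p = q" if "encode p = encode q" for p q
    using that
  proof (induction p arbitrary: q)
    case (Fork p1 p2) then show ?case by (cases q) (simp_all, presburger+)
  next
    case (Comp p1 p2) then show ?case by (cases q) (simp_all, presburger+)
  next
    case (PrimRec p1 p2) then show ?case by (cases q) (simp_all, presburger+)
  next
    case (Mu p) then show ?case by (cases q) (simp_all, presburger+)
  qed (case_tac q; simp)+
qed

lemma surj_encode: "surj encode"
proof -
  have "\<exists>p. encode p = n" for n
  proof (induction n rule: less_induct)
    case (less n)
    show ?case
    proof (cases "n < 5")
      case True
      then have "n = 0 \<or> n = 1 \<or> n = 2 \<or> n = 3 \<or> n = 4" by auto
      then show ?thesis
        using encode.simps(1-5) by metis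
    next
      case False
      define m where "m = (n - 5) div 4"
      obtain a b where ab: "m = npair a b" by (metis prod_decode_inverse surj_pair)
      have mn: "m < n" using False by (simp add: m_def)
      have "a < n" "b < n"
        using mn le_prod_encode_1[of a b] le_prod_encode_2[of b a] by (simp_all add: ab)
      then obtain p q where pq: "encode p = a" "encode q = b" using less by blast
      obtain r where r: "encode r = m" using less mn by blast
      have "n = 5 + 4 * m \<or> n = 6 + 4 * m \<or> n = 7 + 4 * m \<or> n = 8 + 4 * m"
        using False unfolding m_def by presburger
      then show ?thesis
        using encode.simps(6-9) ab pq r by metis
    qed
  qed
  then show ?thesis by (metis surjI)
qed

lemma bij_encode: "bij encode"
  using inj_encode surj_encode by (rule bijI)

definition decode :: "nat \<Rightarrow> prog" where
  "decode = inv encode"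

definition phi :: "nat set \<Rightarrow> nat \<Rightarrow> nat \<Rightarrow> nat option" where
  "phi A e = eval A (decode e)"

definition W_in :: "nat set \<Rightarrow> nat \<Rightarrow> nat set" where
  "W_in A e = dom (phi A e)"

text \<open>Absence of an oracle is rendered by the empty oracle.\<close>

abbreviation W :: "nat \<Rightarrow> nat set" where
  "W \<equiv> W_in {}"

definition ce :: "nat set \<Rightarrow> bool" where
  "ce A \<longleftrightarrow> (\<exists>e. A = W e)"

definition computable_in :: "nat set \<Rightarrow> (nat \<Rightarrow> nat) \<Rightarrow> bool" where
  "computable_in A f \<longleftrightarrow> (\<exists>e. \<forall>x. phi A e x = Some (f x))"

definition computable_in2 :: "nat set \<Rightarrow> (nat \<Rightarrow> nat \<Rightarrow> nat) \<Rightarrow> bool" where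
  "computable_in2 A h \<longleftrightarrow> (\<exists>e. \<forall>x y. phi A e (npair x y) = Some (h x y))"

abbreviation computable :: "(nat \<Rightarrow> nat) \<Rightarrow> bool" where
  "computable \<equiv> computable_in {}"

definition turing_le :: "nat set \<Rightarrow> nat set \<Rightarrow> bool" where
  "turing_le B A \<longleftrightarrow> computable_in A (\<lambda>x. if x \<in> B then 1 else 0)"

definition turing_equiv :: "nat set \<Rightarrow> nat set \<Rightarrow> bool" where
  "turing_equiv A B \<longleftrightarrow> turing_le A B \<and> turing_le B A"

definition jump :: "nat set \<Rightarrow> nat set" where
  "jump A = {e. e \<in> W_in A e}"

definition low :: "nat set \<Rightarrow> bool" where
  "low A \<longleftrightarrow> turing_equiv (jump A) (jump {})"

end

theory Submission
  imports Defs
begin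

text \<open>
  The number \<open>h n x\<close> is an index of the empty set if \<open>npair n x \<in> A\<close> and of all of \<open>\<omega>\<close>
  otherwise. For the \<open>e\<close>-th function \<open>f\<close> there are infinitely many arguments \<open>n = npair e k\<close>
  reserved. As soon as \<open>f n = x\<close> and \<open>0 \<in> W x\<close> are seen for one of them, \<open>npair n x\<close> is put into
  \<open>A\<close>, and \<open>f\<close> is defeated for good at \<open>n\<close>; if this never happens, then \<open>0 \<notin> W (f n)\<close> at some
  reserved \<open>n\<close>, which defeats \<open>f\<close> as well. Each \<open>e\<close> thus contributes at most one element, so \<open>A\<close>
  can be made low by a finite injury argument: \<open>e\<close> must respect the computations that witness
  \<open>i \<in> jump A\<close> for \<open>i \<le> e\<close>.
\<close>

section \<open>Oracle-independent computability\<close>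

abbreviation pfst :: "nat \<Rightarrow> nat" where
  "pfst x \<equiv> fst (prod_decode x)"

abbreviation psnd :: "nat \<Rightarrow> nat" where
  "psnd x \<equiv> snd (prod_decode x)"

text \<open>The program may not depend on the oracle, so the same one works relative to
  \<open>{}\<close>, to \<open>limit_set\<close> and to a jump.\<close>

definition recursive :: "(nat \<Rightarrow> nat) \<Rightarrow> bool" where
  "recursive f \<longleftrightarrow> (\<exists>p. \<forall>X x. eval X p x = Some (f x))"

definition decidable :: "(nat \<Rightarrow> bool) \<Rightarrow> bool" where
  "decidable P \<longleftrightarrow> recursive (\<lambda>x. if P x then 1 else 0)"

lemma recursive_comp:
  assumes "recursive f" "recursive g"
  shows "recursive (\<lambda>x. f (g x))"
proof -
  obtain p q where "\<forall>X x. eval X p x = Some (f x)" "\<forall>X x. eval X q x = Some (g x)"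
    using assms unfolding recursive_def by blast
  then have "\<forall>X x. eval X (Comp p q) x = Some (f (g x))" by simp
  then show ?thesis unfolding recursive_def by blast
qed

lemma decidable_comp: "decidable P \<Longrightarrow> recursive g \<Longrightarrow> decidable (\<lambda>x. P (g x))"
  unfolding decidable_def by (rule recursive_comp)

lemma recursive_pair:
  assumes "recursive f" "recursive g"
  shows "recursive (\<lambda>x. npair (f x) (g x))"
proof -
  obtain p q where "\<forall>X x. eval X p x = Some (f x)" "\<forall>X x. eval X q x = Some (g x)"
    using assms unfolding recursive_def by blast
  then have "\<forall>X x. eval X (Fork p q) x = Some (npair (f x) (g x))" by simp
  then show ?thesis unfolding recursive_def by blast
qed

lemma recursive_pfst: "recursive f \<Longrightarrow> recursive (\<lambda>x. pfst (f x))"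
  by (rule recursive_comp[where f = pfst]) (auto simp: recursive_def intro: exI[of _ Lft])

lemma recursive_psnd: "recursive f \<Longrightarrow> recursive (\<lambda>x. psnd (f x))"
  by (rule recursive_comp[where f = psnd]) (auto simp: recursive_def intro: exI[of _ Rgt])

lemma recursive_Suc: "recursive f \<Longrightarrow> recursive (\<lambda>x. Suc (f x))"
  by (rule recursive_comp[where f = Suc]) (auto simp: recursive_def intro: exI[of _ Succ])

lemma recursive_id: "recursive (\<lambda>x. x)"
  unfolding recursive_def by (rule exI[of _ "Fork Lft Rgt"]) simp

primrec const_prog :: "nat \<Rightarrow> prog" where
  "const_prog 0 = Zero"
| "const_prog (Suc n) = Comp Succ (const_prog n)"

lemma eval_const_prog [simp]: "eval X (const_prog n) x = Some n"
  by (induction n) simp_all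

lemma recursive_const: "recursive (\<lambda>x. c)"
  unfolding recursive_def by (rule exI[of _ "const_prog c"]) simp

text \<open>\<open>PrimRec\<close> hands parameter, counter and previous value to the step program
  as one nested pair, hence the shape of the hypothesis on \<open>g\<close>. The arithmetic below
  arises by choosing \<open>g\<close>.\<close>

lemma recursive_rec_nat:
  assumes "recursive f" "recursive (\<lambda>z. g (pfst z) (pfst (psnd z)) (psnd (psnd z)))" "recursive n"
  shows "recursive (\<lambda>x. rec_nat (f x) (g x) (n x))"
proof -
  obtain p q where p: "\<forall>X x. eval X p x = Some (f x)"
    and q: "\<forall>X z. eval X q z = Some (g (pfst z) (pfst (psnd z)) (psnd (psnd z)))"
    using assms(1,2) unfolding recursive_def by blast
  have "rec_nat (Some (f a)) (\<lambda>m r. Option.bind r (\<lambda>v. Some (g a m v))) k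
      = Some (rec_nat (f a) (g a) k)" for a k
    by (induction k) simp_all
  then have "\<forall>X x. eval X (PrimRec p q) x = Some (rec_nat (f (pfst x)) (g (pfst x)) (psnd x))"
    using p q by (simp add: split_beta)
  then have "recursive (\<lambda>x. rec_nat (f (pfst x)) (g (pfst x)) (psnd x))"
    unfolding recursive_def by blast
  from recursive_comp[OF this recursive_pair[OF recursive_id assms(3)]] show ?thesis
    by simp
qed

lemma recursive_add:
  assumes "recursive f" "recursive g"
  shows "recursive (\<lambda>x. f x + g x)"
proof -
  have "rec_nat a (\<lambda>m r. Suc r) b = a + b" for a b :: nat
    by (induction b) simp_all
  then show ?thesis
    using recursive_rec_nat[OF assms(1) _ assms(2), of "\<lambda>_ _ r. Suc r"]
    by (simp add: recursive_Suc recursive_psnd recursive_id)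
qed

lemma recursive_mult:
  assumes "recursive f" "recursive g"
  shows "recursive (\<lambda>x. f x * g x)"
proof -
  have "rec_nat 0 (\<lambda>m r. r + a) b = a * b" for a b :: nat
    by (induction b) simp_all
  then show ?thesis
    using recursive_rec_nat[OF recursive_const _ assms(2), of "\<lambda>x _ r. r + f x" 0]
    by (simp add: recursive_add recursive_psnd recursive_pfst recursive_id recursive_comp[OF assms(1)])
qed

lemma recursive_power:
  assumes "recursive g"
  shows "recursive (\<lambda>x. c ^ g x)"
proof -
  have "rec_nat 1 (\<lambda>m r. r * c) b = c ^ b" for b :: nat
    by (induction b) simp_all
  then show ?thesis
    using recursive_rec_nat[OF recursive_const _ assms(1), of "\<lambda>x _ r. r * c" 1]
    by (simp add: recursive_mult recursive_psnd recursive_const recursive_id)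
qed

lemma recursive_diff:
  assumes "recursive f" "recursive g"
  shows "recursive (\<lambda>x. f x - g x)"
proof -
  have pred: "rec_nat 0 (\<lambda>m r. m) b = b - 1" for b :: nat
    by (induction b) simp_all
  have *: "recursive (\<lambda>x. h x - 1)" if "recursive h" for h
    using recursive_rec_nat[OF recursive_const _ that, of "\<lambda>_ m _. m" 0]
    by (simp add: pred recursive_pfst recursive_psnd recursive_id)
  have "rec_nat a (\<lambda>m r. r - 1) b = a - b" for a b :: nat
    by (induction b) simp_all
  then show ?thesis
    using recursive_rec_nat[OF assms(1) _ assms(2), of "\<lambda>_ _ r. r - 1"] *
    by (simp add: recursive_psnd recursive_id)
qed

lemma recursive_if:
  assumes "decidable P" "recursive f" "recursive g"
  shows "recursive (\<lambda>x. if P x then f x else g x)"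
proof -
  \<comment> \<open>The characteristic functions of \<open>P\<close> and of its complement serve as
    coefficients, which turns the case distinction into arithmetic.\<close>
  have "recursive (\<lambda>x. (if P x then 1 else 0) * f x + (1 - (if P x then 1 else 0)) * g x)"
    using assms(1) unfolding decidable_def
    by (intro recursive_add recursive_mult recursive_diff recursive_const assms(2,3))
  also have "(\<lambda>x. (if P x then 1 else 0) * f x + (1 - (if P x then 1 else 0)) * g x)
      = (\<lambda>x. if P x then f x else g x)"
    by auto
  finally show ?thesis .
qed

section \<open>Closure properties of decidable predicates\<close>

lemma decidable_const: "decidable (\<lambda>x. b)"
  unfolding decidable_def by (cases b) (simp_all add: recursive_const)

lemma decidable_not:
  assumes "decidable P"
  shows "decidable (\<lambda>x. \<not> P x)"
proof -
  have "recursive (\<lambda>x. if P x then 0 else 1)"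
    by (intro recursive_if assms recursive_const)
  also have "(\<lambda>x. if P x then 0 else 1) = (\<lambda>x. if \<not> P x then 1 else (0::nat))"
    by auto
  finally show ?thesis unfolding decidable_def .
qed

lemma decidable_conj:
  assumes "decidable P" "decidable Q"
  shows "decidable (\<lambda>x. P x \<and> Q x)"
proof -
  have "recursive (\<lambda>x. if P x then if Q x then 1 else 0 else 0)"
    using assms(2) by (intro recursive_if assms(1) recursive_const) (simp_all add: decidable_def)
  also have "(\<lambda>x. if P x then if Q x then 1 else 0 else 0) = (\<lambda>x. if P x \<and> Q x then 1 else (0::nat))"
    by auto
  finally show ?thesis unfolding decidable_def .
qed

lemma decidable_disj: "decidable P \<Longrightarrow> decidable Q \<Longrightarrow> decidable (\<lambda>x. P x \<or> Q x)"
  using decidable_not[OF decidable_conj[OF decidable_not decidable_not], of P Q] by simp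

lemma decidable_imp: "decidable P \<Longrightarrow> decidable Q \<Longrightarrow> decidable (\<lambda>x. P x \<longrightarrow> Q x)"
  unfolding imp_conv_disj by (intro decidable_disj decidable_not)

lemma decidable_iff: "decidable P \<Longrightarrow> decidable Q \<Longrightarrow> decidable (\<lambda>x. P x \<longleftrightarrow> Q x)"
  unfolding iff_conv_conj_imp by (intro decidable_conj decidable_imp)

lemma decidable_le:
  assumes "recursive f" "recursive g"
  shows "decidable (\<lambda>x. f x \<le> g x)"
proof -
  \<comment> \<open>Truncated subtraction: \<open>f x - g x\<close> vanishes exactly when
    \<open>f x \<le> g x\<close>.\<close>
  have "recursive (\<lambda>x. 1 - (f x - g x))"
    by (intro recursive_diff recursive_const assms)
  also have "(\<lambda>x. 1 - (f x - g x)) = (\<lambda>x. if f x \<le> g x then 1 else 0)"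
    by auto
  finally show ?thesis unfolding decidable_def .
qed

lemma decidable_less: "recursive f \<Longrightarrow> recursive g \<Longrightarrow> decidable (\<lambda>x. f x < g x)"
  using decidable_le[of "\<lambda>x. Suc (f x)" g] by (simp add: recursive_Suc Suc_le_eq)

lemma decidable_eq: "recursive f \<Longrightarrow> recursive g \<Longrightarrow> decidable (\<lambda>x. f x = g x)"
  unfolding eq_iff by (intro decidable_conj decidable_le)

lemma decidable_bex_less:
  assumes "decidable (\<lambda>z. P (pfst z) (psnd z))" "recursive b"
  shows "decidable (\<lambda>x. \<exists>v<b x. P x v)"
proof -
  have "rec_nat 0 (\<lambda>m r. if P x m then 1 else r) n = (if \<exists>v<n. P x v then 1 else (0::nat))" for x n
    by (induction n) (auto simp: less_Suc_eq)
  moreover have "recursive (\<lambda>x. rec_nat 0 (\<lambda>m r. if P x m then 1 else r) (b x))"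
    by (intro recursive_rec_nat recursive_if recursive_const assms(2) recursive_psnd recursive_id)
      (use decidable_comp[OF assms(1), of "\<lambda>z. npair (pfst z) (pfst (psnd z))"] in
        \<open>simp add: recursive_pair recursive_pfst recursive_psnd recursive_id\<close>)
  ultimately show ?thesis unfolding decidable_def by simp
qed

lemma decidable_ball_less:
  assumes "decidable (\<lambda>z. P (pfst z) (psnd z))" "recursive b"
  shows "decidable (\<lambda>x. \<forall>v<b x. P x v)"
  using decidable_not[OF decidable_bex_less[OF decidable_not[OF assms(1)] assms(2)]] by simp

lemma decidable_bex_le:
  assumes "decidable (\<lambda>z. P (pfst z) (psnd z))" "recursive b"
  shows "decidable (\<lambda>x. \<exists>v\<le>b x. P x v)"
  using decidable_bex_less[OF assms(1) recursive_Suc[OF assms(2)]] by (simp add: less_Suc_eq_le)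

lemma decidable_ball_le:
  assumes "decidable (\<lambda>z. P (pfst z) (psnd z))" "recursive b"
  shows "decidable (\<lambda>x. \<forall>v\<le>b x. P x v)"
  using decidable_ball_less[OF assms(1) recursive_Suc[OF assms(2)]] by (simp add: less_Suc_eq_le)

text \<open>Bit \<open>i\<close> of \<open>s\<close> is set when the quotient by
  \<open>2 ^ i\<close> is odd. With bounded quotient and remainder, only operations and quantifiers
  with known closure properties remain.\<close>

lemma mem_set_decode_iff:
  "i \<in> set_decode s \<longleftrightarrow> (\<exists>q<Suc s. \<exists>r<2 ^ i. s = (2 * q + 1) * 2 ^ i + r)"
proof
  assume "i \<in> set_decode s"
  then have "odd (s div 2 ^ i)" by (simp add: set_decode_def)
  then obtain q where q: "s div 2 ^ i = 2 * q + 1" by (rule oddE)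
  have s: "s = (2 * q + 1) * 2 ^ i + s mod 2 ^ i"
    using q by (metis div_mult_mod_eq)
  have "q \<le> s"
    using q div_le_dividend[of s "2 ^ i"] by linarith
  then show "\<exists>q<Suc s. \<exists>r<2 ^ i. s = (2 * q + 1) * 2 ^ i + r"
    using s by (intro exI[of _ q] exI[of _ "s mod 2 ^ i"] conjI) (auto simp del: power_Suc)
next
  assume "\<exists>q<Suc s. \<exists>r<2 ^ i. s = (2 * q + 1) * 2 ^ i + r"
  then obtain q r where s: "s = (2 * q + 1) * 2 ^ i + r" and r: "r < 2 ^ i" by blast
  have "s div 2 ^ i = 2 * q + 1"
    unfolding s by (rule div_nat_eqI) (use r in \<open>auto simp: algebra_simps\<close>)
  then show "i \<in> set_decode s" by (simp add: set_decode_def)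
qed

lemmas rec_basic_intros =
  recursive_pair recursive_pfst recursive_psnd recursive_id recursive_const recursive_Suc
  recursive_add recursive_mult recursive_power recursive_if
  decidable_const decidable_not decidable_conj decidable_disj decidable_imp decidable_iff
  decidable_eq decidable_le decidable_less decidable_bex_less decidable_ball_less
  decidable_bex_le decidable_ball_le

lemma decidable_mem_set_decode:
  assumes "recursive i" "recursive s"
  shows "decidable (\<lambda>x. i x \<in> set_decode (s x))"
  unfolding mem_set_decode_iff
  by (intro rec_basic_intros assms assms[THEN recursive_comp])

lemma mem_set_decode_less: "i \<in> set_decode s \<Longrightarrow> i < s"
proof -
  assume "i \<in> set_decode s"
  then have "s div 2 ^ i \<noteq> 0" by (auto simp: set_decode_def intro: ccontr)
  then have "2 ^ i \<le> s" by (auto simp: div_eq_0_iff)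
  then show "i < s" using less_exp[of i] by linarith
qed

lemma decode_encode [simp]: "decode (encode p) = p"
  unfolding decode_def by (simp add: inj_encode)

lemma encode_decode [simp]: "encode (decode e) = e"
  unfolding decode_def by (simp add: surj_encode surj_f_inv_f)

section \<open>Computations as finite sets of claims\<close>

text \<open>
  A claim \<open>(p, x, y)\<close> says that \<open>p\<close> maps \<open>x\<close> to \<open>y\<close>.
  A set of claims each of which follows from others in the set needs no order of derivation:
  every justification goes to a proper subprogram or to a smaller recursion argument, so it cannot
  be circular.
\<close>

primrec justified :: "nat set \<Rightarrow> (prog \<times> nat \<times> nat) set \<Rightarrow> prog \<Rightarrow> nat \<Rightarrow> nat \<Rightarrow> bool" where
  "justified X F Zero x y \<longleftrightarrow> y = 0"
| "justified X F Succ x y \<longleftrightarrow> y = Suc x"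
| "justified X F Lft x y \<longleftrightarrow> y = pfst x"
| "justified X F Rgt x y \<longleftrightarrow> y = psnd x"
| "justified X F Query x y \<longleftrightarrow> y = (if x \<in> X then 1 else 0)"
| "justified X F (Fork p q) x y \<longleftrightarrow> (\<exists>a b. (p, x, a) \<in> F \<and> (q, x, b) \<in> F \<and> y = npair a b)"
| "justified X F (Comp p q) x y \<longleftrightarrow> (\<exists>b. (q, x, b) \<in> F \<and> (p, b, y) \<in> F)"
| "justified X F (PrimRec p q) x y \<longleftrightarrow>
    psnd x = 0 \<and> (p, pfst x, y) \<in> F \<or>
    (\<exists>m v. psnd x = Suc m \<and> (PrimRec p q, npair (pfst x) m, v) \<in> F \<and>
      (q, npair (pfst x) (npair m v), y) \<in> F)"
| "justified X F (Mu p) x y \<longleftrightarrow>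
    (p, npair x y, 0) \<in> F \<and> (\<forall>m<y. \<exists>v. v \<noteq> 0 \<and> (p, npair x m, v) \<in> F)"

definition self_justified :: "nat set \<Rightarrow> (prog \<times> nat \<times> nat) set \<Rightarrow> bool" where
  "self_justified X F \<longleftrightarrow> (\<forall>p x y. (p, x, y) \<in> F \<longrightarrow> justified X F p x y)"

lemma justified_mono: "justified X F p x y \<Longrightarrow> F \<subseteq> G \<Longrightarrow> justified X G p x y"
  by (cases p) (simp; blast)+

lemma self_justified_Union:
  assumes "\<And>i. i \<in> I \<Longrightarrow> self_justified X (F i)"
  shows "self_justified X (\<Union>i\<in>I. F i)"
  unfolding self_justified_def
proof (intro allI impI)
  fix p x y assume "(p, x, y) \<in> (\<Union>i\<in>I. F i)"
  then obtain i where "i \<in> I" "(p, x, y) \<in> F i" by blast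
  then show "justified X (\<Union>i\<in>I. F i) p x y"
    using assms justified_mono[of X "F i" p x y "\<Union>i\<in>I. F i"] unfolding self_justified_def by blast
qed

lemma self_justified_Un:
  "self_justified X F \<Longrightarrow> self_justified X G \<Longrightarrow> self_justified X (F \<union> G)"
  unfolding self_justified_def by (meson Un_iff justified_mono sup_ge1 sup_ge2)

lemma self_justified_insert:
  "self_justified X F \<Longrightarrow> justified X F p x y \<Longrightarrow> self_justified X (insert (p, x, y) F)"
  unfolding self_justified_def by (metis Pair_inject insert_iff justified_mono subset_insertI)

lemma self_justified_sound:
  assumes "self_justified X F" "(p, x, y) \<in> F"
  shows "eval X p x = Some y"
  using assms(2)
proof (induction p arbitrary: x y)
  case (Fork p q)
  then have "justified X F (Fork p q) x y" using assms(1) unfolding self_justified_def by blast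
  with Fork.IH show ?case by fastforce
next
  case (Comp p q)
  then have "justified X F (Comp p q) x y" using assms(1) unfolding self_justified_def by blast
  with Comp.IH show ?case by fastforce
next
  case (PrimRec p q)
  \<comment> \<open>A claim about \<open>PrimRec p q\<close> may rest on one about the same program
    with a smaller counter, so an inner induction on the counter is required.\<close>
  have "(PrimRec p q, npair a n, y) \<in> F \<Longrightarrow> eval X (PrimRec p q) (npair a n) = Some y" for a n y
  proof (induction n arbitrary: y)
    case 0
    then have "justified X F (PrimRec p q) (npair a 0) y"
      using assms(1) unfolding self_justified_def by blast
    with PrimRec.IH show ?case by simp
  next
    case (Suc n)
    then have "justified X F (PrimRec p q) (npair a (Suc n)) y"
      using assms(1) unfolding self_justified_def by blast
    then obtain v where "(PrimRec p q, npair a n, v) \<in> F" "(q, npair a (npair n v), y) \<in> F"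
      by auto
    with Suc.IH PrimRec.IH(2) show ?case by simp
  qed
  then show ?case using PrimRec.prems by (metis prod_decode_inverse surj_pair)
next
  case (Mu p)
  then have "justified X F (Mu p) x y" using assms(1) unfolding self_justified_def by blast
  then have y: "eval X p (npair x y) = Some 0" and
    less: "\<forall>m<y. \<exists>v. v \<noteq> 0 \<and> eval X p (npair x m) = Some v"
    using Mu.IH by (simp, metis justified.simps(9))
  have "(LEAST n. eval X p (npair x n) = Some 0) = y"
    by (rule Least_equality[where P = "\<lambda>n. eval X p (npair x n) = Some 0"])
      (use y less in \<open>force simp: not_less[symmetric]\<close>)+
  moreover have "\<forall>m<y. eval X p (npair x m) \<noteq> None" using less by auto
  with y have "\<exists>n. eval X p (npair x n) = Some 0 \<and> (\<forall>m<n. eval X p (npair x m) \<noteq> None)"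
    by blast
  ultimately show ?case by simp
qed (use assms(1) in \<open>fastforce simp: self_justified_def\<close>)+

text \<open>Claims are collected bottom-up: the union of finite self-justified sets for the
  immediate subcomputations is self-justified, and it justifies the new claim.\<close>

lemma self_justified_complete:
  "eval X p x = Some y \<Longrightarrow> \<exists>F. finite F \<and> self_justified X F \<and> (p, x, y) \<in> F"
proof (induction p arbitrary: x y)
  case (Fork p q)
  from Fork.prems obtain a b where ab: "eval X p x = Some a" "eval X q x = Some b" "y = npair a b"
    by (auto simp: bind_eq_Some_conv)
  with Fork.IH obtain F G where
    "finite F" "self_justified X F" "(p, x, a) \<in> F" "finite G" "self_justified X G" "(q, x, b) \<in> G"
    by meson
  with ab show ?case
    by (intro exI[of _ "insert (Fork p q, x, y) (F \<union> G)"])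
      (auto intro!: self_justified_insert self_justified_Un)
next
  case (Comp p q)
  from Comp.prems obtain b where b: "eval X q x = Some b" "eval X p b = Some y"
    by (auto simp: bind_eq_Some_conv)
  with Comp.IH obtain F G where
    "finite F" "self_justified X F" "(p, b, y) \<in> F" "finite G" "self_justified X G" "(q, x, b) \<in> G"
    by meson
  with b show ?case
    by (intro exI[of _ "insert (Comp p q, x, y) (F \<union> G)"])
      (auto intro!: self_justified_insert self_justified_Un)
next
  case (PrimRec p q)
  have "eval X (PrimRec p q) (npair a n) = Some y \<Longrightarrow>
      \<exists>F. finite F \<and> self_justified X F \<and> (PrimRec p q, npair a n, y) \<in> F" for a n y
  proof (induction n arbitrary: y)
    case 0
    then have "eval X p a = Some y" by simp
    with PrimRec.IH(1) obtain F where "finite F" "self_justified X F" "(p, a, y) \<in> F" by meson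
    then show ?case
      by (intro exI[of _ "insert (PrimRec p q, npair a 0, y) F"])
        (auto intro!: self_justified_insert)
  next
    case (Suc n)
    then obtain v where "eval X (PrimRec p q) (npair a n) = Some v"
      "eval X q (npair a (npair n v)) = Some y"
      by (auto simp: bind_eq_Some_conv)
    with Suc.IH PrimRec.IH(2) obtain F G where
      "finite F" "self_justified X F" "(PrimRec p q, npair a n, v) \<in> F"
      "finite G" "self_justified X G" "(q, npair a (npair n v), y) \<in> G"
      by meson
    then show ?case
      by (intro exI[of _ "insert (PrimRec p q, npair a (Suc n), y) (F \<union> G)"])
        (auto intro!: self_justified_insert self_justified_Un)
  qed
  then show ?case using PrimRec.prems by (metis prod_decode_inverse surj_pair)
next
  case (Mu p)
  let ?P = "\<lambda>n. eval X p (npair x n) = Some 0"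
  from Mu.prems have ex: "\<exists>n. ?P n \<and> (\<forall>m<n. eval X p (npair x m) \<noteq> None)"
    and y: "y = (LEAST n. ?P n)"
    by (auto split: if_splits)
  from ex obtain k where "?P k" by blast
  then have "?P y" unfolding y by (rule LeastI)
  have "y \<le> n" if "?P n" for n using that y by (simp add: Least_le)
  with ex have defined: "\<forall>m<y. eval X p (npair x m) \<noteq> None" by (meson less_le_trans)
  define v where "v m = the (eval X p (npair x m))" for m
  have v: "eval X p (npair x m) = Some (v m)" if "m < y" for m
    using defined that by (simp add: v_def)
  have v0: "v m \<noteq> 0" if "m < y" for m
    using not_less_Least[of m ?P] that v[of m] y by auto
  \<comment> \<open>\<open>w\<close> extends the nonzero values below \<open>y\<close> by the value
    0 at \<open>y\<close>, so that one family \<open>F\<close> covers both conditions for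
    \<open>Mu\<close>.\<close>
  define w where "w m = (if m < y then v m else 0)" for m
  have "\<exists>F. finite F \<and> self_justified X F \<and> (p, npair x m, w m) \<in> F" if "m \<le> y" for m
    using Mu.IH[of "npair x m" "w m"] that v \<open>?P y\<close> by (cases "m = y") (auto simp: w_def)
  then obtain F where F: "\<And>m. m \<le> y \<Longrightarrow> finite (F m) \<and> self_justified X (F m) \<and> (p, npair x m, w m) \<in> F m"
    by metis
  let ?G = "\<Union>m\<in>{..y}. F m"
  have "(p, npair x m, w m) \<in> ?G" if "m \<le> y" for m using F that by blast
  moreover from this[of y] have "(p, npair x y, 0) \<in> ?G" by (simp add: w_def)
  ultimately have "justified X ?G (Mu p) x y"
    using v0 unfolding justified.simps by (metis less_imp_le w_def)
  then show ?case using F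
    by (intro exI[of _ "insert (Mu p, x, y) ?G"])
      (auto intro!: self_justified_insert self_justified_Union)
next
  case Query
  then show ?case by (intro exI[of _ "{(Query, x, y)}"]) (auto simp: self_justified_def)
qed (rule exI[of _ "{(_, _, _)}"], force simp: self_justified_def)+

section \<open>Codes of computations and the normal form\<close>

definition claim :: "nat \<Rightarrow> nat \<Rightarrow> nat \<Rightarrow> nat" where
  "claim e x y = npair e (npair x y)"

definition claims :: "nat \<Rightarrow> (prog \<times> nat \<times> nat) set" where
  "claims d = {(p, x, y). claim (encode p) x y \<in> set_decode d}"

definition valid :: "nat set \<Rightarrow> nat \<Rightarrow> bool" where
  "valid X d \<longleftrightarrow> self_justified X (claims d)"

text \<open>This is Kleene's T predicate: the binary digits of \<open>d\<close> list the claims that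
  make up the computation.\<close>

definition computes :: "nat set \<Rightarrow> nat \<Rightarrow> nat \<Rightarrow> nat \<Rightarrow> nat \<Rightarrow> bool" where
  "computes X d e x y \<longleftrightarrow> valid X d \<and> claim e x y \<in> set_decode d"

text \<open>Pairing and binary coding dominate their components. This bounds both the use of a coded
  computation and the quantifiers that describe it.\<close>

lemma claim_mem_bounds:
  assumes "claim e x y \<in> set_decode d"
  shows "e < d" "x < d" "y < d"
proof -
  have "npair e (npair x y) < d" using mem_set_decode_less[OF assms] by (simp add: claim_def)
  moreover have "e \<le> npair e (npair x y)" "npair x y \<le> npair e (npair x y)"
    "x \<le> npair x y" "y \<le> npair x y"
    by (rule le_prod_encode_1 le_prod_encode_2)+
  ultimately show "e < d" "x < d" "y < d" by linarith+
qed

lemma phi_eq_Some_iff: "phi X e x = Some y \<longleftrightarrow> (\<exists>d. computes X d e x y)"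
proof
  assume "phi X e x = Some y"
  then obtain F where F: "finite F" "self_justified X F" "(decode e, x, y) \<in> F"
    using self_justified_complete unfolding phi_def by blast
  define d where "d = set_encode ((\<lambda>(p, x, y). claim (encode p) x y) ` F)"
  have "set_decode d = (\<lambda>(p, x, y). claim (encode p) x y) ` F"
    unfolding d_def using F(1) by simp
  then have "claims d = F"
    by (auto simp: claims_def claim_def inj_eq[OF inj_encode] image_iff split_beta) force
  then have "computes X d e x y"
    using F unfolding computes_def valid_def claims_def by auto
  then show "\<exists>d. computes X d e x y" ..
next
  assume "\<exists>d. computes X d e x y"
  then show "phi X e x = Some y"
    unfolding phi_def computes_def valid_def using self_justified_sound[of X _ "decode e" x y]
    by (auto simp: claims_def)
qed

text \<open>Use principle: the oracle matters only for claims about \<open>Query\<close>, and these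
  ask about numbers below \<open>d\<close>.\<close>

lemma valid_use:
  assumes "valid X d" "\<And>x. x < d \<Longrightarrow> x \<in> X \<longleftrightarrow> x \<in> Y"
  shows "valid Y d"
  unfolding valid_def self_justified_def
proof (intro allI impI)
  fix p x y assume mem: "(p, x, y) \<in> claims d"
  then have "x < d" unfolding claims_def using claim_mem_bounds(2) by blast
  moreover have "justified X (claims d) p x y"
    using assms(1) mem unfolding valid_def self_justified_def by blast
  ultimately show "justified Y (claims d) p x y"
    using assms(2) by (cases p) auto
qed

text \<open>Programs are replaced by indices and all quantifiers are bounded, so that the closure
  rules for decidable predicates apply to validity.\<close>

lemma justified_decode_iff:
  fixes d :: nat
  defines "C \<equiv> \<lambda>e x y. claim e x y \<in> set_decode d"
  assumes "x < d" "y < d"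
  shows "justified X (claims d) (decode e) x y \<longleftrightarrow>
    e = 0 \<and> y = 0 \<or> e = 1 \<and> y = Suc x \<or> e = 2 \<and> y = pfst x \<or> e = 3 \<and> y = psnd x \<or>
    e = 4 \<and> (if x \<in> X then 1 else 0) = y \<or>
    (\<exists>p<e. \<exists>q<e. e = 5 + 4 * npair p q \<and> (\<exists>a<d. \<exists>b<d. C p x a \<and> C q x b \<and> y = npair a b)) \<or>
    (\<exists>p<e. \<exists>q<e. e = 6 + 4 * npair p q \<and> (\<exists>b<d. C q x b \<and> C p b y)) \<or>
    (\<exists>p<e. \<exists>q<e. e = 7 + 4 * npair p q \<and>
      (psnd x = 0 \<and> C p (pfst x) y \<or>
       (\<exists>m<d. \<exists>v<d. psnd x = Suc m \<and> C e (npair (pfst x) m) v \<and> C q (npair (pfst x) (npair m v)) y))) \<or>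
    (\<exists>p<e. e = 8 + 4 * p \<and> C p (npair x y) 0 \<and> (\<forall>m<y. \<exists>v<d. v \<noteq> 0 \<and> C p (npair x m) v))"
proof -
  \<comment> \<open>A coded claim has all its components below \<open>d\<close>, so witnesses in
    \<open>justified\<close> may be bounded by \<open>d\<close>.\<close>
  have C: "C e x y \<longleftrightarrow> C e x y \<and> e < d \<and> x < d \<and> y < d" for e x y
    unfolding C_def using claim_mem_bounds by blast
  have mem: "(p, x, y) \<in> claims d \<longleftrightarrow> C (encode p) x y" for p x y
    unfolding C_def claims_def by simp
  \<comment> \<open>Codes of the four compound constructors lie in different residue classes modulo
    4, so at most one of the compound disjuncts can hold.\<close>
  have mod: "5 + 4 * m \<noteq> 6 + 4 * n" "5 + 4 * m \<noteq> 7 + 4 * n" "5 + 4 * m \<noteq> 8 + 4 * n"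
    "6 + 4 * m \<noteq> 7 + 4 * n" "6 + 4 * m \<noteq> 8 + 4 * n" "7 + 4 * m \<noteq> 8 + 4 * n"
    for m n :: nat by presburger+
  have bnd: "p < c + 4 * npair p q" "q < c + 4 * npair p q" if "0 < c" for c p q :: nat
    using that le_prod_encode_1[of p q] le_prod_encode_2[of q p] by linarith+
  obtain r where r: "e = encode r" by (metis encode_decode)
  then have dec: "decode e = r" by simp
  show ?thesis
  proof (cases r)
    case (Fork p q)
    have "justified X (claims d) (decode e) x y \<longleftrightarrow>
      (\<exists>a<d. \<exists>b<d. C (encode p) x a \<and> C (encode q) x b \<and> y = npair a b)"
      unfolding r decode_encode Fork justified.simps mem using C by blast
    then show ?thesis
      unfolding r Fork encode.simps using bnd[of 5] mod mod[symmetric] by auto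
  next
    case (Comp p q)
    have "justified X (claims d) (decode e) x y \<longleftrightarrow>
      (\<exists>b<d. C (encode q) x b \<and> C (encode p) b y)"
      unfolding r decode_encode Comp justified.simps mem using C by blast
    then show ?thesis
      unfolding r Comp encode.simps using bnd[of 6] mod mod[symmetric] by auto
  next
    case (PrimRec p q)
    have "psnd x \<le> x" by (metis le_prod_encode_2 prod.collapse prod_decode_inverse)
    then have "m < d" if "psnd x = Suc m" for m
      using that assms(2) by linarith
    then have "justified X (claims d) (decode e) x y \<longleftrightarrow>
      (psnd x = 0 \<and> C (encode p) (pfst x) y \<or>
       (\<exists>m<d. \<exists>v<d. psnd x = Suc m \<and> C e (npair (pfst x) m) v \<and>
         C (encode q) (npair (pfst x) (npair m v)) y))"
      unfolding r decode_encode PrimRec justified.simps mem using C by blast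
    then show ?thesis
      unfolding r PrimRec encode.simps using bnd[of 7] mod mod[symmetric] by auto
  next
    case (Mu p)
    have "justified X (claims d) (decode e) x y \<longleftrightarrow>
      C (encode p) (npair x y) 0 \<and> (\<forall>m<y. \<exists>v<d. v \<noteq> 0 \<and> C (encode p) (npair x m) v)"
      unfolding r decode_encode Mu justified.simps mem using C by blast
    then show ?thesis
      unfolding r Mu encode.simps using mod mod[symmetric] by auto
  qed (unfold dec, auto simp: r)
qed

lemma valid_iff:
  "valid X d \<longleftrightarrow> (\<forall>e<d. \<forall>x<d. \<forall>y<d. claim e x y \<in> set_decode d \<longrightarrow>
    justified X (claims d) (decode e) x y)"
proof -
  have "valid X d \<longleftrightarrow> (\<forall>e x y. claim e x y \<in> set_decode d \<longrightarrow> justified X (claims d) (decode e) x y)"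
    unfolding valid_def self_justified_def claims_def mem_Collect_eq prod.case
    by (metis decode_encode encode_decode)
  then show ?thesis using claim_mem_bounds by blast
qed

lemma recursive_claim:
  "recursive f \<Longrightarrow> recursive g \<Longrightarrow> recursive h \<Longrightarrow> recursive (\<lambda>z. claim (f z) (g z) (h z))"
  unfolding claim_def by (intro recursive_pair)

lemma decidable_valid:
  assumes "recursive a" "recursive d"
  shows "decidable (\<lambda>z. valid (set_decode (a z)) (d z))"
proof -
  note intros = rec_basic_intros decidable_mem_set_decode recursive_claim
  have "decidable (\<lambda>z. valid (set_decode (pfst z)) (psnd z))"
    unfolding valid_iff
    \<comment> \<open>The congruence rules make the bounds of the quantifiers in
      \<open>valid_iff\<close> available as the premises \<open>x < d\<close> and
      \<open>y < d\<close> of the rewrite rule.\<close>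
    by (simp only: justified_decode_iff cong: imp_cong conj_cong) (intro intros)
  from decidable_comp[OF this recursive_pair[OF assms]] show ?thesis by simp
qed

lemma decidable_computes:
  assumes "recursive a" "recursive d" "recursive e" "recursive x" "recursive y"
  shows "decidable (\<lambda>z. computes (set_decode (a z)) (d z) (e z) (x z) (y z))"
  unfolding computes_def
  by (intro decidable_conj decidable_valid decidable_mem_set_decode recursive_claim assms)

section \<open>Reductions to the jump\<close>

lemma phi_encode [simp]: "phi X (encode p) = eval X p"
  unfolding phi_def by simp

lemma computable_inI: "(\<And>x. eval X p x = Some (f x)) \<Longrightarrow> computable_in X f"
  unfolding computable_in_def by (metis phi_encode)

lemma domain_exists_decidable:
  assumes "decidable P"
  shows "\<exists>p. \<forall>X. dom (eval X p) = {x. \<exists>s. P (npair x s)}"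
proof -
  \<comment> \<open>Truth is coded by 0 because \<open>Mu\<close> searches for a zero; totality
    keeps the search from getting stuck.\<close>
  have "recursive (\<lambda>z. if P z then 0 else 1)"
    by (intro recursive_if assms recursive_const)
  then obtain q where q: "\<forall>X z. eval X q z = Some (if P z then 0 else 1)"
    unfolding recursive_def by blast
  have "dom (eval X (Mu q)) = {x. \<exists>s. P (npair x s)}" for X
    by (auto simp: dom_def q split: if_splits)
  then show ?thesis by blast
qed

lemma recursive_encode_const_prog: "recursive (\<lambda>x. encode (const_prog x))"
proof -
  \<comment> \<open>The step is the code of \<open>Comp Succ\<close> applied to a program with code
    \<open>r\<close>; the 1 is \<open>encode Succ\<close>, the initial 0 is
    \<open>encode Zero\<close>.\<close>
  have "rec_nat 0 (\<lambda>m r. 6 + 4 * npair 1 r) n = encode (const_prog n)" for n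
    by (induction n) simp_all
  moreover have "recursive (\<lambda>x. rec_nat 0 (\<lambda>m r. 6 + 4 * npair 1 r) x)"
    by (intro recursive_rec_nat rec_basic_intros)
  ultimately show ?thesis by simp
qed

text \<open>An instance of the s-m-n theorem: \<open>g x\<close> indexes a program that ignores its
  input and searches for a witness for \<open>x\<close>. Running it on its own index therefore asks
  the same question, whatever the oracle.\<close>

lemma reduction_to_jump:
  assumes "decidable P"
  shows "\<exists>g. recursive g \<and> (\<forall>X x. g x \<in> jump X \<longleftrightarrow> (\<exists>s. P (npair x s)))"
proof -
  obtain p where p: "\<And>X. dom (eval X p) = {x. \<exists>s. P (npair x s)}"
    using domain_exists_decidable[OF assms] by blast
  define g where "g x = encode (Comp p (const_prog x))" for x
  have "recursive g"
    unfolding g_def encode.simps by (intro rec_basic_intros recursive_encode_const_prog)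
  moreover have "g x \<in> jump X \<longleftrightarrow> (\<exists>s. P (npair x s))" for X x
  proof -
    have "g x \<in> jump X \<longleftrightarrow> x \<in> dom (eval X p)"
      by (simp add: jump_def W_in_def g_def dom_def del: encode.simps)
    then show ?thesis by (simp add: p)
  qed
  ultimately show ?thesis by blast
qed

lemma query_jump_prog:
  assumes "decidable P"
  shows "\<exists>p. \<forall>X x. eval (jump X) p x = Some (if \<exists>s. P (npair x s) then 1 else 0)"
proof -
  obtain g where g: "recursive g" "\<And>X x. g x \<in> jump X \<longleftrightarrow> (\<exists>s. P (npair x s))"
    using reduction_to_jump[OF assms] by blast
  then obtain p where "\<forall>X x. eval X p x = Some (g x)" unfolding recursive_def by blast
  then have "\<forall>X x. eval (jump X) (Comp Query p) x = Some (if \<exists>s. P (npair x s) then 1 else 0)"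
    by (simp add: g(2))
  then show ?thesis by blast
qed

text \<open>One direction of Shoenfield's limit lemma. The jump decides whether a guess will ever
  change after a given stage; a search finds a stage without later change, and its guess is
  final.\<close>

lemma limit_le_jump:
  assumes dec: "decidable (\<lambda>z. G (pfst z) (psnd z))"
    and lim: "\<And>i. \<forall>\<^sub>F s in sequentially. G i s \<longleftrightarrow> i \<in> B"
  shows "turing_le B (jump X)"
proof -
  define changes where "changes z \<longleftrightarrow> (\<exists>t\<ge>psnd z. G (pfst z) t \<noteq> G (pfst z) (psnd z))" for z
  have "decidable (\<lambda>w. psnd (pfst w) \<le> psnd w \<and>
      \<not> (G (pfst (pfst w)) (psnd w) \<longleftrightarrow> G (pfst (pfst w)) (psnd (pfst w))))"
    using decidable_comp[OF dec, of "\<lambda>w. npair (pfst (pfst w)) (psnd w)"]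
      decidable_comp[OF dec, of pfst]
    by (intro decidable_conj decidable_not decidable_iff decidable_le)
      (simp_all add: recursive_pair recursive_pfst recursive_psnd recursive_id)
  from query_jump_prog[OF this]
  obtain q where q: "\<And>z. eval (jump X) q z = Some (if changes z then 1 else 0)"
    unfolding changes_def by auto
  obtain p where p: "\<And>Y z. eval Y p z = Some (if G (pfst z) (psnd z) then 1 else 0)"
    using dec unfolding decidable_def recursive_def by blast
  have "eval (jump X) (Comp p (Fork (Fork Lft Rgt) (Mu q))) i = Some (if i \<in> B then 1 else 0)" for i
  proof -
    obtain N where N: "\<And>s. s \<ge> N \<Longrightarrow> G i s \<longleftrightarrow> i \<in> B"
      using lim[of i] unfolding eventually_sequentially by blast
    define s where "s = (LEAST s. \<not> changes (npair i s))"
    have "\<not> changes (npair i N)" unfolding changes_def using N by simp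
    then have s: "\<not> changes (npair i s)" unfolding s_def by (rule LeastI)
    have "G i (max s N) \<longleftrightarrow> G i s"
      using s unfolding changes_def by (metis fst_conv max.cobounded1 prod_encode_inverse snd_conv)
    then have "G i s \<longleftrightarrow> i \<in> B" using N[of "max s N"] by simp
    moreover have "eval (jump X) (Mu q) i = Some s"
      using s by (auto simp: q s_def if_distrib cong: if_cong)
    ultimately show ?thesis by (simp add: p del: eval.simps(9))
  qed
  then show ?thesis unfolding turing_le_def by (rule computable_inI)
qed

text \<open>The bound on the output loses nothing by \<open>claim_mem_bounds\<close>. As
  \<open>d\<close> is an exact code and not a step count, larger numbers need not be witnesses;
  hence the quantifier \<open>\<exists>d\<le>s\<close> at stages.\<close>

definition halts :: "nat set \<Rightarrow> nat \<Rightarrow> nat \<Rightarrow> nat \<Rightarrow> bool" where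
  "halts X d e x \<longleftrightarrow> (\<exists>y<d. computes X d e x y)"

lemma mem_W_in_iff: "x \<in> W_in X e \<longleftrightarrow> (\<exists>d. halts X d e x)"
proof -
  have "x \<in> W_in X e \<longleftrightarrow> (\<exists>y d. computes X d e x y)"
    by (simp add: W_in_def dom_def phi_eq_Some_iff)
  then show ?thesis
    unfolding halts_def computes_def using claim_mem_bounds(3) by blast
qed

lemma halts_use:
  "halts X d e x \<Longrightarrow> (\<And>z. z < d \<Longrightarrow> z \<in> X \<longleftrightarrow> z \<in> Y) \<Longrightarrow> halts Y d e x"
  unfolding halts_def computes_def using valid_use by blast

lemma decidable_halts:
  assumes "recursive a" "recursive d" "recursive e" "recursive x"
  shows "decidable (\<lambda>z. halts (set_decode (a z)) (d z) (e z) (x z))"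
  unfolding halts_def
  by (intro decidable_bex_less decidable_computes recursive_psnd recursive_id assms
      assms[THEN recursive_comp] recursive_pfst)

lemma jump_empty_le_jump: "turing_le (jump {}) (jump X)"
proof -
  \<comment> \<open>\<open>set_decode 0\<close> expresses the empty oracle as a coded finite set, to
    which \<open>decidable_halts\<close> applies.\<close>
  have "decidable (\<lambda>z. halts (set_decode 0) (psnd z) (pfst z) (pfst z))"
    by (intro decidable_halts rec_basic_intros)
  from query_jump_prog[OF this]
  obtain p where "\<And>x. eval (jump X) p x = Some (if x \<in> jump {} then 1 else 0)"
    by (auto simp: jump_def mem_W_in_iff)
  then show ?thesis unfolding turing_le_def by (rule computable_inI)
qed

section \<open>The construction\<close>

text \<open>
  The number \<open>c = npair (npair e k) x\<close> stands for the argument \<open>n = npair e k\<close> of the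
  \<open>e\<close>-th function and the possible value \<open>x\<close> there. Each \<open>c\<close> is considered at infinitely many
  stages, namely at all \<open>s = npair c t\<close>.
\<close>

definition tag :: "nat \<Rightarrow> nat" where
  "tag c = pfst (pfst c)"

definition candidate :: "nat \<Rightarrow> nat \<Rightarrow> bool" where
  "candidate s c \<longleftrightarrow>
    (\<exists>d\<le>s. computes {} d (tag c) (pfst c) (psnd c)) \<and> (\<exists>d\<le>s. halts {} d (psnd c) 0)"

text \<open>
  If the least witness \<open>d\<close> of a computation of \<open>i\<close> exceeds \<open>c\<close>, then enumerating \<open>c\<close> might
  destroy it; otherwise the computation is safe, since it queries only numbers below \<open>d\<close>.
\<close>

definition permitted :: "nat set \<Rightarrow> nat \<Rightarrow> nat \<Rightarrow> bool" where
  "permitted X s c \<longleftrightarrow>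
    (\<forall>i\<le>tag c. (\<exists>d\<le>s. halts X d i i) \<longrightarrow> (\<exists>d\<le>c. halts X d i i))"

text \<open>The last conjunct lets each tag act at most once. Its bound \<open>c < a\<close> keeps
  the quantifier decidable and omits no member of \<open>set_decode a\<close>.\<close>

definition enters :: "nat \<Rightarrow> nat \<Rightarrow> bool" where
  "enters a s \<longleftrightarrow> candidate s (pfst s) \<and> permitted (set_decode a) s (pfst s) \<and>
    (\<forall>c<a. c \<in> set_decode a \<longrightarrow> tag c \<noteq> tag (pfst s))"

primrec stage :: "nat \<Rightarrow> nat" where
  "stage 0 = 0"
| "stage (Suc s) = (if enters (stage s) s then 2 ^ pfst s + stage s else stage s)"

definition approx :: "nat \<Rightarrow> nat set" where
  "approx s = set_decode (stage s)"

definition limit_set :: "nat set" where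
  "limit_set = (\<Union>s. approx s)"

lemma decidable_enters:
  assumes "recursive a" "recursive s"
  shows "decidable (\<lambda>z. enters (a z) (s z))"
  unfolding enters_def candidate_def permitted_def tag_def set_decode_zero[symmetric]
  by (intro rec_basic_intros decidable_computes decidable_halts decidable_mem_set_decode assms
      assms[THEN recursive_comp])

lemma recursive_stage:
  assumes "recursive f"
  shows "recursive (\<lambda>x. stage (f x))"
proof -
  have "rec_nat 0 (\<lambda>s a. if enters a s then 2 ^ pfst s + a else a) n = stage n" for n
    by (induction n) simp_all
  moreover have "recursive (\<lambda>x. rec_nat 0 (\<lambda>s a. if enters a s then 2 ^ pfst s + a else a) (f x))"
    by (intro recursive_rec_nat rec_basic_intros decidable_enters assms)
  ultimately show ?thesis by simp
qed

lemma ce_limit_set: "ce limit_set"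
proof -
  have "decidable (\<lambda>z. pfst z \<in> set_decode (stage (psnd z)))"
    by (intro decidable_mem_set_decode recursive_stage rec_basic_intros)
  from domain_exists_decidable[OF this]
  obtain p where "\<And>X. dom (eval X p) = {x. \<exists>s. x \<in> set_decode (stage s)}"
    by auto
  moreover have "limit_set = {x. \<exists>s. x \<in> set_decode (stage s)}"
    by (auto simp: limit_set_def approx_def)
  ultimately have "limit_set = W (encode p)" by (simp add: W_in_def)
  then show ?thesis unfolding ce_def by blast
qed

text \<open>An element already present would block its own tag. Hence adding
  \<open>2 ^ pfst s\<close> in \<open>stage\<close> sets a clear bit and causes no carry.\<close>

lemma enters_not_mem: "enters a s \<Longrightarrow> pfst s \<notin> set_decode a"
  unfolding enters_def using mem_set_decode_less by blast

lemma approx_Suc: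
  "approx (Suc s) = (if enters (stage s) s then insert (pfst s) (approx s) else approx s)"
  by (simp add: approx_def set_decode_plus_power_2 enters_not_mem)

lemma approx_mono: "s \<le> t \<Longrightarrow> approx s \<subseteq> approx t"
  by (rule lift_Suc_mono_le) (auto simp: approx_Suc)

lemma limit_set_candidate: "c \<in> limit_set \<Longrightarrow> \<exists>s. candidate s c"
proof -
  have "c \<in> approx s \<Longrightarrow> \<exists>s. candidate s c" for s
  proof (induction s)
    case 0
    then show ?case by (simp add: approx_def)
  next
    case (Suc s)
    then show ?case by (auto simp: approx_Suc enters_def split: if_splits)
  qed
  then show "c \<in> limit_set \<Longrightarrow> \<exists>s. candidate s c" unfolding limit_set_def by blast
qed

text \<open>Once an element with tag \<open>e\<close> has entered, it stays and blocks every later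
  one.\<close>

lemma eventually_no_entry:
  "\<forall>\<^sub>F s in sequentially. enters (stage s) s \<longrightarrow> tag (pfst s) \<noteq> e"
proof (cases "\<exists>s. enters (stage s) s \<and> tag (pfst s) = e")
  case True
  then obtain s where s: "enters (stage s) s" "tag (pfst s) = e" by blast
  have "tag (pfst t) \<noteq> e" if "t \<ge> Suc s" "enters (stage t) t" for t
  proof -
    have "pfst s \<in> approx (Suc s)" using s(1) by (simp add: approx_Suc)
    then have "pfst s \<in> set_decode (stage t)"
      using approx_mono[OF that(1)] unfolding approx_def by blast
    then show ?thesis
      using that(2) s(2) mem_set_decode_less unfolding enters_def by blast
  qed
  then show ?thesis unfolding eventually_sequentially by blast
next
  case False
  then show ?thesis by (intro always_eventually) blast
qed

text \<open>The injuries are finite: only finitely many tags lie below \<open>i\<close>, and each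
  acts at most once. Afterwards every entering element must respect the computation of
  \<open>i\<close>.\<close>

lemma eventually_entry_ge:
  "\<forall>\<^sub>F s in sequentially. enters (stage s) s \<longrightarrow> i \<le> tag (pfst s)"
proof -
  have "\<forall>\<^sub>F s in sequentially. \<forall>e\<in>{..<i}. enters (stage s) s \<longrightarrow> tag (pfst s) \<noteq> e"
    by (intro eventually_ball_finite ballI eventually_no_entry) simp
  then show ?thesis by eventually_elim (auto simp: not_less[symmetric])
qed

section \<open>Convergence of the approximations and lowness\<close>

lemma eventually_approx_mem: "\<forall>\<^sub>F s in sequentially. x \<in> approx s \<longleftrightarrow> x \<in> limit_set"
proof (cases "x \<in> limit_set")
  case True
  then obtain s where "x \<in> approx s" unfolding limit_set_def by blast
  then have "\<forall>t\<ge>s. x \<in> approx t" using approx_mono by blast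
  then show ?thesis using True unfolding eventually_sequentially by blast
next
  case False
  then show ?thesis unfolding limit_set_def by simp
qed

lemma eventually_halts_approx:
  assumes "halts limit_set d e x"
  shows "\<forall>\<^sub>F s in sequentially. halts (approx s) d e x"
proof -
  have "\<forall>\<^sub>F s in sequentially. \<forall>z\<in>{..<d}. z \<in> approx s \<longleftrightarrow> z \<in> limit_set"
    by (intro eventually_ball_finite ballI eventually_approx_mem) simp
  then show ?thesis by eventually_elim (use halts_use[OF assms] in auto)
qed

text \<open>The least witness \<open>u\<close> at stage \<open>s\<close> survives: as long as
  nothing changes below \<open>u\<close>, it stays least, and permission then forces every entering
  element to be at least \<open>u\<close>, beyond the queries of that computation.\<close>

lemma computation_preserved:
  assumes quiet: "\<And>t. s \<le> t \<Longrightarrow> enters (stage t) t \<Longrightarrow> i \<le> tag (pfst t)"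
    and "d \<le> s" "halts (approx s) d i i"
  shows "\<exists>u\<le>s. halts limit_set u i i \<and> (\<forall>t\<ge>s. halts (approx t) u i i)"
proof -
  define u where "u = (LEAST u. halts (approx s) u i i)"
  have u: "halts (approx s) u i i" unfolding u_def using assms(3) by (rule LeastI)
  have "u \<le> s" unfolding u_def using assms(2,3) Least_le le_trans by metis
  have least: "\<not> halts (approx s) v i i" if "v < u" for v
    using that unfolding u_def by (rule not_less_Least)
  have agree: "\<forall>z<u. z \<in> approx t \<longleftrightarrow> z \<in> approx s" if "s \<le> t" for t
    using that
  proof (induction t rule: dec_induct)
    case (step t)
    have "u \<le> pfst t" if ent: "enters (stage t) t"
    proof -
      have "halts (approx t) u i i" using halts_use[OF u] step.IH by blast
      then obtain v where v: "v \<le> pfst t" "halts (approx t) v i i"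
        using ent quiet[OF step.hyps(1) ent] \<open>u \<le> s\<close> step.hyps(1)
        unfolding enters_def permitted_def approx_def by (meson le_trans)
      \<comment> \<open>Since \<open>approx t\<close> and \<open>approx s\<close> agree below
        \<open>u\<close>, a smaller witness at \<open>t\<close> would already be one at
        \<open>s\<close>, against minimality.\<close>
      have "\<not> v < u"
      proof
        assume "v < u"
        then have "halts (approx s) v i i" using halts_use[OF v(2)] step.IH by simp
        then show False using least \<open>v < u\<close> by blast
      qed
      then show ?thesis using v(1) by simp
    qed
    then show ?case using step.IH by (auto simp: approx_Suc)
  qed simp
  have "\<forall>t\<ge>s. halts (approx t) u i i" using halts_use[OF u] agree by blast
  moreover have "z \<in> approx s \<longleftrightarrow> z \<in> limit_set" if "z < u" for z
  proof -
    have "\<exists>t\<ge>s. z \<in> approx t \<longleftrightarrow> z \<in> limit_set"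
      using eventually_approx_mem[of z] unfolding eventually_sequentially by (meson nat_le_linear)
    then show ?thesis using agree that by blast
  qed
  then have "halts limit_set u i i" by (rule halts_use[OF u])
  ultimately show ?thesis using \<open>u \<le> s\<close> by blast
qed

text \<open>Convergence of the guess gives lowness; the bound \<open>b\<close> says that
  \<open>i\<close> restrains only finitely much, which the diagonalization needs. Any witness seen
  after the injuries is preserved, and a genuine computation is eventually seen.\<close>

lemma jump_limit_set_approx:
  "\<exists>b. \<forall>\<^sub>F s in sequentially. ((\<exists>d\<le>s. halts (approx s) d i i) \<longleftrightarrow> i \<in> jump limit_set) \<and>
    (i \<in> jump limit_set \<longrightarrow> (\<exists>d\<le>b. halts (approx s) d i i))"
proof -
  obtain N where N: "\<And>t. N \<le> t \<Longrightarrow> enters (stage t) t \<Longrightarrow> i \<le> tag (pfst t)"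
    using eventually_entry_ge[of i] unfolding eventually_sequentially by blast
  have jump: "i \<in> jump limit_set \<longleftrightarrow> (\<exists>d. halts limit_set d i i)"
    by (simp add: jump_def mem_W_in_iff)
  show ?thesis
  proof (cases "\<exists>s\<ge>N. \<exists>d\<le>s. halts (approx s) d i i")
    case True
    then obtain s d where "N \<le> s" "d \<le> s" "halts (approx s) d i i" by blast
    then obtain u where u: "u \<le> s" "halts limit_set u i i" "\<forall>t\<ge>s. halts (approx t) u i i"
      using computation_preserved[of s i d] N by (meson le_trans)
    have "\<forall>t\<ge>s. ((\<exists>d\<le>t. halts (approx t) d i i) \<longleftrightarrow> i \<in> jump limit_set) \<and>
        (i \<in> jump limit_set \<longrightarrow> (\<exists>d\<le>s. halts (approx t) d i i))"
      using u jump by (meson le_trans)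
    then show ?thesis unfolding eventually_sequentially by blast
  next
    case False
    have "\<not> halts limit_set d i i" for d
    proof
      assume "halts limit_set d i i"
      then have "\<forall>\<^sub>F s in sequentially. halts (approx s) d i i \<and> d \<le> s \<and> N \<le> s"
        by (intro eventually_conj eventually_halts_approx eventually_ge_at_top)
      then show False using False by (auto simp: eventually_sequentially)
    qed
    then show ?thesis using False jump unfolding eventually_sequentially by blast
  qed
qed

lemma low_limit_set: "low limit_set"
proof -
  have "decidable (\<lambda>z. \<exists>d\<le>psnd z. halts (approx (psnd z)) d (pfst z) (pfst z))"
    unfolding approx_def by (intro rec_basic_intros decidable_halts recursive_stage)
  moreover have "\<forall>\<^sub>F s in sequentially.
      (\<exists>d\<le>s. halts (approx s) d i i) \<longleftrightarrow> i \<in> jump limit_set" for i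
    using jump_limit_set_approx[of i] by (auto elim: eventually_mono)
  ultimately have "turing_le (jump limit_set) (jump {})" by (rule limit_le_jump)
  then show ?thesis unfolding low_def turing_equiv_def using jump_empty_le_jump by blast
qed

section \<open>The function \<open>h\<close> and the diagonalization\<close>

definition empty_index :: nat where
  "empty_index = encode (Mu (const_prog 1))"

text \<open>The search for a zero of the constant function 1 never ends.\<close>

lemma W_empty_index: "W empty_index = {}"
  by (simp add: W_in_def empty_index_def dom_def del: encode.simps const_prog.simps)

lemma W_encode_Zero: "W (encode Zero) = UNIV"
  by (simp add: W_in_def dom_def del: encode.simps)

lemma mem_limit_setI:
  assumes cand: "candidate s c" and free: "\<And>c'. c' \<in> limit_set \<Longrightarrow> tag c' \<noteq> tag c"
    and large: "\<And>i t. i \<le> tag c \<Longrightarrow> s \<le> t \<Longrightarrow> \<exists>d\<le>t. halts (approx t) d i i \<Longrightarrow>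
      \<exists>d\<le>c. halts (approx t) d i i"
  shows "c \<in> limit_set"
proof -
  \<comment> \<open>Among the stages that consider \<open>c\<close>, this one is at least
    \<open>s\<close>, so everything seen by stage \<open>s\<close> is still available.\<close>
  define t where "t = npair c s"
  have t: "pfst t = c" "s \<le> t" by (simp_all add: t_def le_prod_encode_2)
  have "candidate t c" using cand t(2) unfolding candidate_def by (meson le_trans)
  moreover have "permitted (set_decode (stage t)) t c"
    using large t(2) unfolding permitted_def approx_def by blast
  moreover have "tag c' \<noteq> tag c" if "c' \<in> set_decode (stage t)" for c'
    using free that unfolding limit_set_def approx_def by blast
  ultimately have "enters (stage t) t" unfolding enters_def t(1) by blast
  then have "c \<in> approx (Suc t)" by (simp add: approx_Suc t(1))
  then show ?thesis unfolding limit_set_def by blast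
qed

definition anti_fixpoint :: "nat \<Rightarrow> nat \<Rightarrow> nat" where
  "anti_fixpoint n x = (if npair n x \<in> limit_set then empty_index else encode Zero)"

lemma computable_anti_fixpoint: "computable_in2 limit_set anti_fixpoint"
proof -
  have "recursive (\<lambda>v. if v = 1 then empty_index else encode Zero)"
    by (intro rec_basic_intros)
  then obtain p where "\<And>X v. eval X p v = Some (if v = 1 then empty_index else encode Zero)"
    unfolding recursive_def by blast
  then have "eval limit_set (Comp p Query) (npair n x) = Some (anti_fixpoint n x)" for n x
    by (simp add: anti_fixpoint_def)
  then show ?thesis unfolding computable_in2_def by (metis phi_encode)
qed

lemma anti_fixpoint_diagonalizes:
  assumes "computable f"
  shows "\<exists>n. W (f n) \<noteq> W (anti_fixpoint n (f n))"
proof (rule ccontr)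
  assume "\<not> ?thesis"
  then have fixpoint: "W (f n) = W (anti_fixpoint n (f n))" for n by blast
  obtain e where e: "\<And>n. phi {} e n = Some (f n)"
    using assms unfolding computable_in_def by blast
  show False
  proof (cases "\<exists>c\<in>limit_set. tag c = e")
    case True
    then obtain c where c: "c \<in> limit_set" "tag c = e" by blast
    then obtain s where "candidate s c" using limit_set_candidate by blast
    \<comment> \<open>The element \<open>c\<close> records \<open>f n = x\<close> and
      \<open>0 \<in> W x\<close> for \<open>n = pfst c\<close> and \<open>x = psnd c\<close>,
      whereas membership of \<open>c\<close> makes \<open>anti_fixpoint n x\<close> an index of the
      empty set.\<close>
    then have "phi {} e (pfst c) = Some (psnd c)" "0 \<in> W (psnd c)"
      using c(2) phi_eq_Some_iff mem_W_in_iff unfolding candidate_def by blast+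
    then show False
      using fixpoint[of "pfst c"] c(1) e W_empty_index by (simp add: anti_fixpoint_def)
  next
    case False
    have "\<exists>b. \<forall>\<^sub>F s in sequentially.
        (\<exists>d\<le>s. halts (approx s) d i i) \<longrightarrow> (\<exists>d\<le>b. halts (approx s) d i i)" for i
    proof -
      obtain b where "\<forall>\<^sub>F s in sequentially.
          ((\<exists>d\<le>s. halts (approx s) d i i) \<longleftrightarrow> i \<in> jump limit_set) \<and>
          (i \<in> jump limit_set \<longrightarrow> (\<exists>d\<le>b. halts (approx s) d i i))"
        using jump_limit_set_approx by blast
      then show ?thesis by (intro exI[of _ b]) (auto elim: eventually_mono)
    qed
    then have "\<forall>i. \<exists>b. \<forall>\<^sub>F s in sequentially.
        (\<exists>d\<le>s. halts (approx s) d i i) \<longrightarrow> (\<exists>d\<le>b. halts (approx s) d i i)" ..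
    from choice[OF this] obtain b where b: "\<And>i. \<forall>\<^sub>F s in sequentially.
        (\<exists>d\<le>s. halts (approx s) d i i) \<longrightarrow> (\<exists>d\<le>b i. halts (approx s) d i i)"
      by blast
    have "\<forall>\<^sub>F s in sequentially. \<forall>i\<in>{..e}.
        (\<exists>d\<le>s. halts (approx s) d i i) \<longrightarrow> (\<exists>d\<le>b i. halts (approx s) d i i)"
      by (intro eventually_ball_finite ballI b) simp
    then obtain N where N: "\<And>i s. i \<le> e \<Longrightarrow> N \<le> s \<Longrightarrow> \<exists>d\<le>s. halts (approx s) d i i \<Longrightarrow>
        \<exists>d\<le>b i. halts (approx s) d i i"
      unfolding eventually_sequentially by blast
    \<comment> \<open>Among the arguments reserved for \<open>e\<close>, one is chosen so large that
      \<open>c\<close> exceeds the final restraints of all \<open>i \<le> e\<close>; only finitely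
      many bounds have to be beaten.\<close>
    define k where "k = Max (b ` {..e})"
    define n where "n = npair e k"
    define c where "c = npair n (f n)"
    have tag: "tag c = e" by (simp add: tag_def c_def n_def)
    have "k \<le> c" unfolding c_def n_def by (meson le_prod_encode_1 le_prod_encode_2 le_trans)
    moreover have "b i \<le> k" if "i \<le> e" for i unfolding k_def using that by simp
    ultimately have bc: "b i \<le> c" if "i \<le> e" for i using that le_trans by blast
    have "c \<notin> limit_set" using False tag by blast
    \<comment> \<open>As \<open>c\<close> stays out, the assumed equality at \<open>n\<close> makes
      \<open>W (f n)\<close> everything. Then 0 appears in it, so \<open>c\<close> becomes a
      candidate and must enter after all.\<close>
    then have "W (f n) = UNIV"
      using fixpoint[of n] W_encode_Zero by (simp add: anti_fixpoint_def c_def)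
    then obtain d where d: "halts {} d (f n) 0" using mem_W_in_iff by blast
    obtain d' where d': "computes {} d' e n (f n)" using e phi_eq_Some_iff by blast
    \<comment> \<open>From this stage on both computations have been seen and the restraint bounds
      \<open>b i\<close> are in force.\<close>
    have "candidate (max N (max d d')) c"
      using d d' unfolding candidate_def tag by (auto simp: c_def intro: exI[of _ d] exI[of _ d'])
    then have "c \<in> limit_set"
    proof (rule mem_limit_setI)
      show "tag c' \<noteq> tag c" if "c' \<in> limit_set" for c' using False tag that by blast
      show "\<exists>d\<le>c. halts (approx t) d i i"
        if "i \<le> tag c" "max N (max d d') \<le> t" "\<exists>d\<le>t. halts (approx t) d i i" for i t
        using N[of i t] bc[of i] that tag by (meson le_trans max.boundedE)
    qed
    with \<open>c \<notin> limit_set\<close> show False by blast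
  qed
qed

theorem mainTheorem1:
  "\<exists>(A :: nat set) (h :: nat \<Rightarrow> nat \<Rightarrow> nat).
     low A \<and> ce A \<and> computable_in2 A h \<and>
     (\<forall>f :: nat \<Rightarrow> nat. computable f \<longrightarrow> (\<exists>n. W (f n) \<noteq> W (h n (f n))))"
  using low_limit_set ce_limit_set computable_anti_fixpoint anti_fixpoint_diagonalizes by blast

end
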